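(* Let $n\ge 2$, let $\bm X=(X_1,\dots,X_n)$ and $Y$ be random variables with finite alphabets $\mathcal X_1,\dots,\mathcal X_n,\mathcal Y$ and joint distribution $p(\bm X,Y)$, and for each $m\ge1$ let $\mathcal S_m=\{(\bm x^{(k)},y^{(k)})\}_{k=1}^m$ be a set of $m$ i.i.d. samples from $p$. Let $\mathcal M$ be the collection of all probability distributions on $\mathcal X_1\times\dots\times\mathcal X_n\times\mathcal Y$. Then $$\mathrm{RSI}(\bm X;Y)=\lim_{m\to\infty}\frac1m\lambda^{\mathcal M}_{\mathcal C_{\mathrm H}}(\mathcal S_m)-\lim_{m\to\infty}\frac1m\lambda^{\mathcal M}_{\mathcal C_{\mathrm T}}(\mathcal S_m)=\inf_{q\in\mathcal C_{\mathrm H}}D(p\,\|\,q)-\inf_{q'\in\mathcal C_{\mathrm T}}D(p\,\|\,q'),$$ where the limits are limits in probability.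
   Context: The redundancy-synergy index is $\mathrm{RSI}(\bm X;Y)=\sum_{j=1}^n I(X_j;Y)-I(\bm X;Y)$, with $I$ the Shannon mutual information. $D(p\,\|\,q)$ is the Kullback–Leibler divergence. All logarithms have the same base. Classes of joint probability distributions on $\mathcal X_1\times\dots\times\mathcal X_n\times\mathcal Y$: the tail-to-tail class $$\mathcal C_{\mathrm T}=\Big\{q: q(\bm X,Y)=q(Y)\prod_{j=1}^n q(X_j\mid Y)\Big\}$$ (all distributions under which $X_1,\dots,X_n$ are conditionally independent given $Y$), and the head-to-head class $$\mathcal C_{\mathrm H}=\Big\{q: q(\bm X,Y)=q(Y\mid\bm X)\prod_{j=1}^n q(X_j)\Big\}$$ (all distributions under which $X_1,\dots,X_n$ are mutually independent, with $Y$ depending arbitrarily on them). The likelihood of a distribution $q$ on the sample is $\Lambda(\mathcal S_m;q)=\prod_{k=1}^m q(\bm x^{(k)},y^{(k)})$, and the generalized likelihood ratio between classes $\mathcal C,\mathcal C'$ is $$\lambda_{\mathcal C'}^{\mathcal C}(\mathcal S_m)=\log\frac{\sup_{r\in\mathcal C}\Lambda(\mathcal S_m;r)}{\sup_{s\in\mathcal C'}\Lambda(\mathcal S_m;s)}.$$ *)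

theory Defs
  imports "HOL-Probability.Probability"
begin

text \<open>
  The alphabets are finite sets \<open>A 0, \<dots>, A (n - 1)\<close> of a common type (they may well be pairwise
  disjoint, so this is no restriction) and a finite set \<open>B\<close>.  A value of the random vector is an
  extensional function on \<open>{..<n}\<close>.
\<close>

definition alphabet :: "nat \<Rightarrow> (nat \<Rightarrow> 'a set) \<Rightarrow> 'b set \<Rightarrow> ((nat \<Rightarrow> 'a) \<times> 'b) set" where
  "alphabet n A B = (\<Pi>\<^sub>E j\<in>{..<n}. A j) \<times> B"

definition random_vector :: "nat \<Rightarrow> (nat \<Rightarrow> 'w \<Rightarrow> 'a) \<Rightarrow> 'w \<Rightarrow> nat \<Rightarrow> 'a" where
  "random_vector n X = (\<lambda>\<omega>. \<lambda>j\<in>{..<n}. X j \<omega>)"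

definition RSI :: "real \<Rightarrow> 'w measure \<Rightarrow> nat \<Rightarrow> (nat \<Rightarrow> 'a set) \<Rightarrow> 'b set
    \<Rightarrow> (nat \<Rightarrow> 'w \<Rightarrow> 'a) \<Rightarrow> ('w \<Rightarrow> 'b) \<Rightarrow> real" where
  "RSI b M n A B X Y =
     (\<Sum>j<n. prob_space.mutual_information M b (count_space (A j)) (count_space B) (X j) Y)
     - prob_space.mutual_information M b (count_space (\<Pi>\<^sub>E j\<in>{..<n}. A j)) (count_space B)
         (random_vector n X) Y"

text \<open>
  The library's \<open>KL_divergence b Q P\<close> is \<open>D(P \<parallel> Q)\<close> (note the order of the arguments), but it has
  no meaningful value unless \<open>P\<close> is absolutely continuous with respect to \<open>Q\<close>; the usual
  convention \<open>D(P \<parallel> Q) = \<infinity>\<close> for the other case is added here.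
\<close>

definition KL :: "real \<Rightarrow> 'c pmf \<Rightarrow> 'c pmf \<Rightarrow> ereal" where
  "KL b p q = (if set_pmf p \<subseteq> set_pmf q
     then ereal (KL_divergence b (measure_pmf q) (measure_pmf p)) else \<infinity>)"

definition all_distributions :: "nat \<Rightarrow> (nat \<Rightarrow> 'a set) \<Rightarrow> 'b set \<Rightarrow> ((nat \<Rightarrow> 'a) \<times> 'b) pmf set" where
  "all_distributions n A B = {q. set_pmf q \<subseteq> alphabet n A B}"

text \<open>
  In both classes below \<open>\<P>(\<dots> \<bar> \<dots>)\<close> is the library's conditional probability, which is \<open>0\<close> when the
  conditioning event has probability \<open>0\<close>.  Where \<open>q(y) = 0\<close> both sides of the tail-to-tail
  equation vanish.  The head-to-head equation yields \<open>q(x) = \<Prod>\<^sub>j q(x\<^sub>j)\<close> whenever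
  \<open>q(x) > 0\<close>; as both sides are probability distributions in \<open>x\<close>, this forces
  \<open>\<Prod>\<^sub>j q(x\<^sub>j) = 0\<close> wherever \<open>q(x) = 0\<close>, so it does express mutual independence.
\<close>

definition tail_to_tail :: "nat \<Rightarrow> (nat \<Rightarrow> 'a set) \<Rightarrow> 'b set \<Rightarrow> ((nat \<Rightarrow> 'a) \<times> 'b) pmf set" where
  "tail_to_tail n A B = {q \<in> all_distributions n A B. \<forall>(x, y)\<in>alphabet n A B.
     pmf q (x, y) = \<P>(z in q. snd z = y) * (\<Prod>j<n. \<P>(z in q. fst z j = x j \<bar> snd z = y))}"

definition head_to_head :: "nat \<Rightarrow> (nat \<Rightarrow> 'a set) \<Rightarrow> 'b set \<Rightarrow> ((nat \<Rightarrow> 'a) \<times> 'b) pmf set" where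
  "head_to_head n A B = {q \<in> all_distributions n A B. \<forall>(x, y)\<in>alphabet n A B.
     pmf q (x, y) = \<P>(z in q. snd z = y \<bar> fst z = x) * (\<Prod>j<n. \<P>(z in q. fst z j = x j))}"

definition likelihood :: "nat \<Rightarrow> (nat \<Rightarrow> 'c) \<Rightarrow> 'c pmf \<Rightarrow> real" where
  "likelihood m s q = (\<Prod>k<m. pmf q (s k))"

definition log_GLR :: "real \<Rightarrow> 'c pmf set \<Rightarrow> 'c pmf set \<Rightarrow> nat \<Rightarrow> (nat \<Rightarrow> 'c) \<Rightarrow> real" where
  "log_GLR b C C' m s =
     log b ((SUP r\<in>C. likelihood m s r) / (SUP r\<in>C'. likelihood m s r))"

definition tendsto_in_probability :: "'w measure \<Rightarrow> (nat \<Rightarrow> 'w \<Rightarrow> real) \<Rightarrow> real \<Rightarrow> bool" where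
  "tendsto_in_probability M Z L \<longleftrightarrow> (\<forall>m. Z m \<in> borel_measurable M) \<and>
     (\<forall>\<epsilon>>0. (\<lambda>m. \<P>(\<omega> in M. \<epsilon> < \<bar>Z m \<omega> - L\<bar>)) \<longlonglongrightarrow> 0)"

end

theory Submission
  imports Defs
begin

text \<open>
  All three classes consist of the distributions on a finite set that factorize as
  \<open>q(z) = \<Prod>\<^sub>i q(f\<^sub>i(z) \<bar> g\<^sub>i(z))\<close> for suitable functions \<open>f\<^sub>i\<close>, \<open>g\<^sub>i\<close>.  By Gibbs' inequality, applied to each
  factor, \<open>\<Sum>\<^sub>z t(z) log q(z)\<close> is maximal over such a class at the member with the same
  conditionals as \<open>t\<close>, where it is a signed sum of entropies of marginals of \<open>t\<close>.  For \<open>t = p\<close> this computes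
  the infimum of \<open>D(p \<parallel> q)\<close>.  For \<open>t\<close> the empirical distribution of the sample it computes
  the supremum of the likelihood, so that the normalized log likelihood ratio is a continuous function of
  the relative frequencies, which converge in probability by Hoeffding's inequality.  Finally the
  redundancy-synergy index is the difference of the two entropy expressions, term by term.
\<close>

section \<open>Convergence in probability\<close>

context prob_space
begin

text \<open>Sample values are known to lie in the alphabet only at points of the space, so the
  formula for the likelihood ratio can be substituted only there.\<close>

lemma tendsto_in_probability_cong:
  assumes "tendsto_in_probability M Z L" "\<And>m \<omega>. \<omega> \<in> space M \<Longrightarrow> Z' m \<omega> = Z m \<omega>"
  shows "tendsto_in_probability M Z' L"
proof -
  have "Z' m \<in> borel_measurable M \<longleftrightarrow> Z m \<in> borel_measurable M" for m
    by (rule measurable_cong) (rule assms(2))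
  moreover have "\<P>(\<omega> in M. \<epsilon> < \<bar>Z' m \<omega> - L\<bar>) = \<P>(\<omega> in M. \<epsilon> < \<bar>Z m \<omega> - L\<bar>)" for \<epsilon> m
    by (rule arg_cong[where f = prob]) (use assms(2) in auto)
  ultimately show ?thesis
    using assms(1) by (simp add: tendsto_in_probability_def)
qed

lemma tendsto_in_probability_const: "tendsto_in_probability M (\<lambda>m \<omega>. c) c"
  by (simp add: tendsto_in_probability_def)

lemma tendsto_in_probability_add:
  assumes "tendsto_in_probability M Z L" "tendsto_in_probability M Z' L'"
  shows "tendsto_in_probability M (\<lambda>m \<omega>. Z m \<omega> + Z' m \<omega>) (L + L')"
proof -
  have [measurable]: "Z m \<in> borel_measurable M" "Z' m \<in> borel_measurable M" for m
    using assms by (auto simp: tendsto_in_probability_def)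
  have "(\<lambda>m. \<P>(\<omega> in M. \<epsilon> < \<bar>Z m \<omega> + Z' m \<omega> - (L + L')\<bar>)) \<longlonglongrightarrow> 0" if "\<epsilon> > 0" for \<epsilon>
  proof (rule tendsto_sandwich[OF _ _ tendsto_const])
    let ?u = "\<lambda>m. \<P>(\<omega> in M. \<epsilon>/2 < \<bar>Z m \<omega> - L\<bar>) + \<P>(\<omega> in M. \<epsilon>/2 < \<bar>Z' m \<omega> - L'\<bar>)"
    show "?u \<longlonglongrightarrow> 0"
      using assms half_gt_zero[OF that] unfolding tendsto_in_probability_def
      by (intro tendsto_add_zero) blast+
    show "\<forall>\<^sub>F m in sequentially. \<P>(\<omega> in M. \<epsilon> < \<bar>Z m \<omega> + Z' m \<omega> - (L + L')\<bar>) \<le> ?u m"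
    proof (rule always_eventually, rule allI)
      fix m
      have "\<P>(\<omega> in M. \<epsilon> < \<bar>Z m \<omega> + Z' m \<omega> - (L + L')\<bar>)
        \<le> prob ({\<omega>\<in>space M. \<epsilon>/2 < \<bar>Z m \<omega> - L\<bar>} \<union> {\<omega>\<in>space M. \<epsilon>/2 < \<bar>Z' m \<omega> - L'\<bar>})"
        by (rule finite_measure_mono) (auto, smt (verit) field_sum_of_halves)
      also have "\<dots> \<le> ?u m"
        by (rule measure_Un_le) auto
      finally show "\<P>(\<omega> in M. \<epsilon> < \<bar>Z m \<omega> + Z' m \<omega> - (L + L')\<bar>) \<le> ?u m" .
    qed
  qed auto
  then show ?thesis by (simp add: tendsto_in_probability_def)
qed

lemma tendsto_in_probability_sum:
  assumes "\<And>i. i \<in> I \<Longrightarrow> tendsto_in_probability M (Z i) (L i)"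
  shows "tendsto_in_probability M (\<lambda>m \<omega>. \<Sum>i\<in>I. Z i m \<omega>) (\<Sum>i\<in>I. L i)"
  using assms
  by (induction I rule: infinite_finite_induct)
    (auto intro: tendsto_in_probability_const tendsto_in_probability_add)

text \<open>The continuous mapping theorem for a constant limit, where continuity at that one point
  suffices. Such continuity does not make \<open>h\<close> measurable, hence the separate
  hypothesis.\<close>

lemma tendsto_in_probability_isCont:
  assumes "tendsto_in_probability M Z L" "isCont h L" "h \<in> borel_measurable borel"
  shows "tendsto_in_probability M (\<lambda>m \<omega>. h (Z m \<omega>)) (h L)"
proof -
  have [measurable]: "Z m \<in> borel_measurable M" for m
    using assms by (auto simp: tendsto_in_probability_def)
  note [measurable] = assms(3)
  have "(\<lambda>m. \<P>(\<omega> in M. \<epsilon> < \<bar>h (Z m \<omega>) - h L\<bar>)) \<longlonglongrightarrow> 0" if "\<epsilon> > 0" for \<epsilon>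
  proof -
    obtain d where d: "d > 0" "\<And>x. \<bar>x - L\<bar> < d \<Longrightarrow> \<bar>h x - h L\<bar> < \<epsilon>"
      using assms(2) \<open>\<epsilon> > 0\<close> unfolding continuous_at_eps_delta dist_real_def by meson
    show ?thesis
    proof (rule tendsto_sandwich[OF _ _ tendsto_const])
      \<comment> \<open>Off this event the inequality is only weak; with \<open>d/2\<close> in place
        of \<open>d\<close> it still gives the strict bound that continuity asks for.\<close>
      show "(\<lambda>m. \<P>(\<omega> in M. d/2 < \<bar>Z m \<omega> - L\<bar>)) \<longlonglongrightarrow> 0"
        using assms(1) half_gt_zero[OF d(1)] unfolding tendsto_in_probability_def by blast
      have "\<P>(\<omega> in M. \<epsilon> < \<bar>h (Z m \<omega>) - h L\<bar>) \<le> \<P>(\<omega> in M. d/2 < \<bar>Z m \<omega> - L\<bar>)" for m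
      proof (rule finite_measure_mono)
        show "{\<omega>\<in>space M. \<epsilon> < \<bar>h (Z m \<omega>) - h L\<bar>} \<subseteq> {\<omega>\<in>space M. d/2 < \<bar>Z m \<omega> - L\<bar>}"
          using d by (smt (verit) Collect_mono field_sum_of_halves)
      qed auto
      then show "\<forall>\<^sub>F m in sequentially. \<P>(\<omega> in M. \<epsilon> < \<bar>h (Z m \<omega>) - h L\<bar>)
          \<le> \<P>(\<omega> in M. d/2 < \<bar>Z m \<omega> - L\<bar>)"
        by simp
    qed auto
  qed
  then show ?thesis by (simp add: tendsto_in_probability_def)
qed

lemma tendsto_in_probability_diff:
  assumes "tendsto_in_probability M Z L" "tendsto_in_probability M Z' L'"
  shows "tendsto_in_probability M (\<lambda>m \<omega>. Z m \<omega> - Z' m \<omega>) (L - L')"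
  using tendsto_in_probability_add[OF assms(1)
      tendsto_in_probability_isCont[OF assms(2), of uminus]]
  by simp

text \<open>A weak law of large numbers for a triangular array: row \<open>m\<close> is an
  independent sample of its own. Hoeffding's bound for a row depends only on \<open>m\<close> and
  \<open>\<epsilon>\<close>, so it tends to 0 whatever the joint law of different rows.\<close>

lemma tendsto_in_probability_relative_frequency:
  fixes S :: "nat \<Rightarrow> nat \<Rightarrow> 'a \<Rightarrow> 'c" and p :: "'c pmf"
  assumes indep: "\<And>m. 1 \<le> m \<Longrightarrow> indep_vars (\<lambda>_. count_space Z) (S m) {..<m}"
    and distr: "\<And>m k. 1 \<le> m \<Longrightarrow> k < m \<Longrightarrow> distr M (count_space UNIV) (S m k) = measure_pmf p"
  shows "tendsto_in_probability M
    (\<lambda>m \<omega>. real (card {k\<in>{..<m}. S m k \<omega> = z}) / real m) (pmf p z)"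
proof -
  let ?X = "\<lambda>m k \<omega>. indicat_real {z} (S m k \<omega>)"
  have S: "S m k \<in> measurable M (count_space Z)" if "k < m" for m k
    using indep[of m] that by (auto simp: indep_vars_def)
  have S'[measurable]: "S m k \<in> measurable M (count_space UNIV)" if "k < m" for m k
    by (rule measurable_compose[OF S[OF that], where g = "\<lambda>x. x"]) auto
  have freq: "real (card {k\<in>{..<m}. S m k \<omega> = z}) = (\<Sum>k<m. ?X m k \<omega>)" for m \<omega>
    by (simp add: indicator_def sum.If_cases if_distrib Int_def)
  have E: "expectation (?X m k) = pmf p z" if "k < m" for m k
  proof -
    have "expectation (?X m k) = (\<integral>x. indicat_real {z} x \<partial>distr M (count_space UNIV) (S m k))"
      using that by (subst integral_distr) auto
    also have "\<dots> = pmf p z"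
      using that distr[of m k] by (simp add: measure_pmf_single)
    finally show ?thesis .
  qed
  \<comment> \<open>For \<open>m = 0\<close> the sum is empty, so measurability holds there
    too.\<close>
  have meas: "(\<lambda>\<omega>. (\<Sum>k<m. ?X m k \<omega>) / real m) \<in> borel_measurable M" for m
    by (intro borel_measurable_divide borel_measurable_sum borel_measurable_const
        measurable_compose[OF S']) auto
  have bound: "\<P>(\<omega> in M. \<epsilon> < \<bar>(\<Sum>k<m. ?X m k \<omega>) / real m - pmf p z\<bar>)
      \<le> 2 * exp (-2 * \<epsilon>\<^sup>2 * real m)" if "\<epsilon> > 0" "1 \<le> m" for \<epsilon> m
  proof -
    interpret H: Hoeffding_ineq M "{..<m}" "?X m" "\<lambda>_. 0" "\<lambda>_. 1" "real m * pmf p z"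
    proof unfold_locales
      show "indep_vars (\<lambda>_. borel) (?X m) {..<m}"
        by (rule indep_vars_compose2[OF indep[OF \<open>1 \<le> m\<close>]]) auto
      show "real m * pmf p z \<equiv> \<Sum>k<m. expectation (?X m k)"
        using E by (auto intro!: eq_reflection)
    qed (auto simp: indicator_def)
    have "\<P>(\<omega> in M. \<epsilon> < \<bar>(\<Sum>k<m. ?X m k \<omega>) / real m - pmf p z\<bar>)
      \<le> \<P>(\<omega> in M. \<bar>(\<Sum>k<m. ?X m k \<omega>) - real m * pmf p z\<bar> \<ge> \<epsilon> * real m)"
    proof (rule finite_measure_mono)
      have "\<epsilon> * real m \<le> \<bar>s - real m * pmf p z\<bar>" if "\<epsilon> < \<bar>s / real m - pmf p z\<bar>" for s
      proof -
        have "\<epsilon> * real m \<le> \<bar>s / real m - pmf p z\<bar> * real m"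
          using that by (intro mult_right_mono) auto
        also have "\<dots> = \<bar>(s / real m - pmf p z) * real m\<bar>"
          by (simp add: abs_mult)
        also have "(s / real m - pmf p z) * real m = s - real m * pmf p z"
          using \<open>1 \<le> m\<close> by (simp add: field_simps)
        finally show ?thesis .
      qed
      then show "{\<omega>\<in>space M. \<epsilon> < \<bar>(\<Sum>k<m. ?X m k \<omega>) / real m - pmf p z\<bar>}
        \<subseteq> {\<omega>\<in>space M. \<bar>(\<Sum>k<m. ?X m k \<omega>) - real m * pmf p z\<bar> \<ge> \<epsilon> * real m}"
        by blast
      show "{\<omega>\<in>space M. \<bar>(\<Sum>k<m. ?X m k \<omega>) - real m * pmf p z\<bar> \<ge> \<epsilon> * real m} \<in> events"
        by measurable
    qed
    also have "\<dots> \<le> 2 * exp (-2 * (\<epsilon> * real m)\<^sup>2 / (\<Sum>k<m. (1 - 0)\<^sup>2))"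
      by (rule H.Hoeffding_ineq_abs_ge) (use that in auto)
    also have "\<dots> = 2 * exp (-2 * \<epsilon>\<^sup>2 * real m)"
      using that by (simp add: power2_eq_square field_simps)
    finally show ?thesis .
  qed
  have "(\<lambda>m. \<P>(\<omega> in M. \<epsilon> < \<bar>(\<Sum>k<m. ?X m k \<omega>) / real m - pmf p z\<bar>)) \<longlonglongrightarrow> 0"
    if "\<epsilon> > 0" for \<epsilon>
  proof (rule tendsto_sandwich[OF _ _ tendsto_const])
    have "((\<lambda>m. exp (-2 * \<epsilon>\<^sup>2 * real m)) \<longlonglongrightarrow> 0)"
      using that
      by (intro filterlim_compose[OF exp_at_bot] filterlim_tendsto_neg_mult_at_bot[OF tendsto_const]
          filterlim_real_sequentially) auto
    then show "((\<lambda>m. 2 * exp (-2 * \<epsilon>\<^sup>2 * real m)) \<longlonglongrightarrow> 0)"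
      by (rule tendsto_mult_right_zero)
    show "\<forall>\<^sub>F m in sequentially. \<P>(\<omega> in M. \<epsilon> < \<bar>(\<Sum>k<m. ?X m k \<omega>) / real m - pmf p z\<bar>)
        \<le> 2 * exp (-2 * \<epsilon>\<^sup>2 * real m)"
      using eventually_ge_at_top[of 1] by eventually_elim (rule bound[OF that])
  qed auto
  with meas show ?thesis
    by (simp only: tendsto_in_probability_def freq) simp
qed

end

text \<open>Frequencies may tend to 0, where the logarithm alone is discontinuous. The factor
  \<open>x\<close> forces the limit 0, which is also the value at 0.\<close>

lemma isCont_x_log_x: "isCont (\<lambda>x. x * log b x) (x::real)"
proof -
  have "isCont (\<lambda>x. x * ln x) x"
  proof (cases "x = 0")
    case False
    then show ?thesis
      using isCont_ln by (intro isCont_mult) auto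
  next
    case True
    have right: "((\<lambda>x. x * ln x) \<longlongrightarrow> 0) (at_right (0::real))"
      by real_asymp
    \<comment> \<open>The real \<open>ln\<close> is even, so the left limit is the negated right
      limit.\<close>
    have "((\<lambda>x. x * ln x) \<longlongrightarrow> 0) (at_left (0::real))"
      unfolding filterlim_at_left_to_right
      using tendsto_minus[OF right] by (simp add: ln_minus)
    with right True show ?thesis
      by (simp add: isCont_def filterlim_split_at)
  qed
  then have "isCont (\<lambda>x. (x * ln x) * (1 / ln b)) x"
    by (rule isCont_mult[OF _ continuous_const])
  moreover have "(\<lambda>x. (x * ln x) * (1 / ln b)) = (\<lambda>x. x * log b x)"
    by (simp add: log_def)
  ultimately show ?thesis by simp
qed

section \<open>Maximum likelihood in factorizing classes\<close>

text \<open>The factorization of a Bayesian network: \<open>f i\<close> is the value at node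
  \<open>i\<close> and \<open>g i\<close> the joint value of its parents. A constant
  \<open>g i\<close> describes a node without parents.\<close>

definition network_density ::
    "'i set \<Rightarrow> ('i \<Rightarrow> 'z \<Rightarrow> 'c) \<Rightarrow> ('i \<Rightarrow> 'z \<Rightarrow> 'd) \<Rightarrow> 'z pmf \<Rightarrow> 'z \<Rightarrow> real" where
  "network_density I f g q z = (\<Prod>i\<in>I. \<P>(w in q. f i w = f i z \<bar> g i w = g i z))"

text \<open>
  For weights \<open>v z = P(z)\<close> this is minus the entropy of \<open>h\<close>.  As a function of arbitrary weights it is
  continuous everywhere, which is what transfers the convergence of the relative frequencies.
\<close>

definition marginal_log_sum :: "real \<Rightarrow> 'z set \<Rightarrow> ('z \<Rightarrow> real) \<Rightarrow> ('z \<Rightarrow> 'c) \<Rightarrow> real" where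
  "marginal_log_sum b Z v h =
     (\<Sum>c\<in>h ` Z. (\<lambda>x. x * log b x) (\<Sum>z\<in>{z \<in> Z. h z = c}. v z))"

text \<open>For a distribution \<open>v\<close> on \<open>Z\<close> this is minus the sum of the
  conditional entropies of \<open>f i\<close> given \<open>g i\<close>, each written as a difference
  of two entropies. Taking plain weights \<open>v\<close> allows relative frequencies to be inserted
  directly, even for an empty sample.\<close>

definition avg_loglik ::
    "real \<Rightarrow> 'i set \<Rightarrow> ('i \<Rightarrow> 'z \<Rightarrow> 'c) \<Rightarrow> ('i \<Rightarrow> 'z \<Rightarrow> 'd) \<Rightarrow> 'z set \<Rightarrow> ('z \<Rightarrow> real) \<Rightarrow> real" where
  "avg_loglik b I f g Z v =
     (\<Sum>i\<in>I. marginal_log_sum b Z v (\<lambda>z. (f i z, g i z)) - marginal_log_sum b Z v (g i))"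

section \<open>Marginals and sums over fibers\<close>

lemma prob_fiber:
  fixes t :: "'z pmf"
  assumes "finite Z" "set_pmf t \<subseteq> Z"
  shows "measure_pmf.prob t {w. h w = c} = (\<Sum>z\<in>{z \<in> Z. h z = c}. pmf t z)"
proof -
  have "measure_pmf.prob t {w. h w = c} = measure t {z \<in> Z. h z = c}"
    using assms(2) by (intro measure_prob_cong_0) (auto simp: set_pmf_eq)
  also have "\<dots> = (\<Sum>z\<in>{z \<in> Z. h z = c}. pmf t z)"
    using assms(1) by (intro measure_measure_pmf_finite) auto
  finally show ?thesis .
qed

lemma prob_fiber_pos:
  assumes "z \<in> set_pmf t"
  shows "measure_pmf.prob t {w. h w = h z} > 0"
proof -
  have "0 < pmf t z" using assms by (simp add: pmf_positive)
  also have "\<dots> = measure t {z}" by (simp add: pmf.rep_eq)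
  also have "\<dots> \<le> measure_pmf.prob t {w. h w = h z}"
    by (rule measure_pmf.finite_measure_mono) auto
  finally show ?thesis .
qed

lemma sum_pmf_fiber:
  fixes t :: "'z pmf"
  assumes "finite Z" "set_pmf t \<subseteq> Z"
  shows "(\<Sum>z\<in>Z. pmf t z * K (h z)) = (\<Sum>c\<in>h ` Z. measure_pmf.prob t {w. h w = c} * K c)"
  using assms
  by (subst sum.image_gen[of Z _ h]) (auto simp: prob_fiber sum_distrib_right intro!: sum.cong)

lemma sum_pmf_log_fiber:
  assumes "finite Z" "set_pmf t \<subseteq> Z"
  shows "(\<Sum>z\<in>Z. pmf t z * log b (measure_pmf.prob t {w. h w = h z})) = marginal_log_sum b Z (pmf t) h"
  using sum_pmf_fiber[OF assms, of "\<lambda>c. log b (measure_pmf.prob t {w. h w = c})" h]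
  by (simp add: marginal_log_sum_def prob_fiber[OF assms])

text \<open>Grouping by the value of \<open>h\<close> cancels the marginal of \<open>t\<close>. Only
  an inequality results: a fiber that is null under \<open>t\<close> contributes 0 on the left and a
  nonnegative amount on the right.\<close>

lemma sum_pmf_change_of_measure:
  fixes t q :: "'z pmf"
  assumes "finite Z" "set_pmf t \<subseteq> Z" "set_pmf q \<subseteq> Z" "\<And>c. K c \<ge> 0"
  shows "(\<Sum>z\<in>Z. pmf t z * (K (h z) * measure_pmf.prob q {w. h w = h z} / measure_pmf.prob t {w. h w = h z}))
    \<le> (\<Sum>z\<in>Z. pmf q z * K (h z))"
proof -
  let ?r = "\<lambda>c. K c * measure_pmf.prob q {w. h w = c} / measure_pmf.prob t {w. h w = c}"
  have "(\<Sum>z\<in>Z. pmf t z * ?r (h z)) = (\<Sum>c\<in>h ` Z. measure_pmf.prob t {w. h w = c} * ?r c)"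
    by (rule sum_pmf_fiber) fact+
  also have "\<dots> \<le> (\<Sum>c\<in>h ` Z. measure_pmf.prob q {w. h w = c} * K c)"
    using assms(4) by (intro sum_mono) (simp add: mult.commute)
  also have "\<dots> = (\<Sum>z\<in>Z. pmf q z * K (h z))"
    by (rule sum_pmf_fiber[symmetric]) fact+
  finally show ?thesis .
qed

section \<open>Gibbs' inequality for factorized densities\<close>

lemma cond_prob_fiber:
  "\<P>(w in measure_pmf q. f w = f z \<bar> g w = g z)
    = measure_pmf.prob q {w. (f w, g w) = (f z, g z)} / measure_pmf.prob q {w. g w = g z}"
  by (simp add: cond_prob_def)

lemma cond_prob_fiber_pos:
  assumes "z \<in> set_pmf q"
  shows "\<P>(w in measure_pmf q. f w = f z \<bar> g w = g z) > 0"
  unfolding cond_prob_fiber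
  using prob_fiber_pos[OF assms, of "\<lambda>z. (f z, g z)"] prob_fiber_pos[OF assms, of g] by simp

lemma Gibbs_inequality_cond_prob:
  fixes t q :: "'z pmf"
  assumes "1 < b" "finite Z" "set_pmf q \<subseteq> Z" "set_pmf t \<subseteq> set_pmf q"
  shows "(\<Sum>z\<in>Z. pmf t z * log b (\<P>(w in q. f w = f z \<bar> g w = g z)))
    \<le> (\<Sum>z\<in>Z. pmf t z * log b (\<P>(w in t. f w = f z \<bar> g w = g z)))"
proof -
  \<comment> \<open>By \<open>ln r \<le> r - 1\<close> it suffices that the expectation under \<open>t\<close> of the ratio of the two conditional
    probabilities is at most 1; two changes of measure, along \<open>(f, g)\<close> and then along \<open>g\<close>, show this.\<close>
  let ?q = "\<lambda>z. \<P>(w in q. f w = f z \<bar> g w = g z)"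
  let ?t = "\<lambda>z. \<P>(w in t. f w = f z \<bar> g w = g z)"
  let ?h = "\<lambda>z. (f z, g z)"
  \<comment> \<open>The ratio of the two conditionals is \<open>?K (g z)\<close> times the ratio of
    the joint probabilities of \<open>(f, g)\<close>, so after the first change of measure only a
    function of \<open>g\<close> is left.\<close>
  let ?K = "\<lambda>c. measure_pmf.prob t {w. g w = c} / measure_pmf.prob q {w. g w = c}"
  have tZ: "set_pmf t \<subseteq> Z" using assms by auto
  have "(\<Sum>z\<in>Z. pmf t z * (?q z / ?t z))
    = (\<Sum>z\<in>Z. pmf t z * (?K (snd (?h z)) * measure_pmf.prob q {w. ?h w = ?h z} / measure_pmf.prob t {w. ?h w = ?h z}))"
    by (simp only: cond_prob_fiber snd_conv) (simp add: field_simps)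
  also have "\<dots> \<le> (\<Sum>z\<in>Z. pmf q z * ?K (snd (?h z)))"
    by (rule sum_pmf_change_of_measure[where K = "\<lambda>c. ?K (snd c)"]) (use assms tZ in auto)
  also have "\<dots> = (\<Sum>z\<in>Z. pmf q z * (1 * measure_pmf.prob t {w. g w = g z} / measure_pmf.prob q {w. g w = g z}))"
    by simp
  also have "\<dots> \<le> (\<Sum>z\<in>Z. pmf t z * 1)"
    by (rule sum_pmf_change_of_measure[where K = "\<lambda>_. 1"]) (use assms tZ in auto)
  finally have le: "(\<Sum>z\<in>Z. pmf t z * (?q z / ?t z)) \<le> (\<Sum>z\<in>Z. pmf t z)" by simp
  have "(\<Sum>z\<in>Z. pmf t z * log b (?q z)) - (\<Sum>z\<in>Z. pmf t z * log b (?t z))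
    = (\<Sum>z\<in>Z. pmf t z * (log b (?q z) - log b (?t z)))"
    by (simp add: sum_subtractf right_diff_distrib)
  also have "\<dots> \<le> (\<Sum>z\<in>Z. pmf t z * ((?q z / ?t z - 1) / ln b))"
  proof (rule sum_mono)
    fix z
    show "pmf t z * (log b (?q z) - log b (?t z)) \<le> pmf t z * ((?q z / ?t z - 1) / ln b)"
    proof (cases "z \<in> set_pmf t")
      case True
      have "?t z > 0"
        by (rule cond_prob_fiber_pos) fact
      have "?q z > 0"
        by (rule cond_prob_fiber_pos) (use True assms(4) in auto)
      have "log b (?q z) - log b (?t z) = ln (?q z / ?t z) / ln b"
        using \<open>?t z > 0\<close> \<open>?q z > 0\<close>
        by (simp add: log_def ln_div diff_divide_distrib)
      also have "\<dots> \<le> (?q z / ?t z - 1) / ln b"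
        using \<open>?t z > 0\<close> \<open>?q z > 0\<close> \<open>1 < b\<close>
        by (intro divide_right_mono ln_le_minus_one) auto
      finally show ?thesis by (intro mult_left_mono) auto
    qed (simp add: set_pmf_iff)
  qed
  also have "\<dots> = ((\<Sum>z\<in>Z. pmf t z * (?q z / ?t z)) - (\<Sum>z\<in>Z. pmf t z)) / ln b"
    by (simp add: sum_subtractf right_diff_distrib diff_divide_distrib sum_divide_distrib)
  also have "\<dots> \<le> 0"
    using le \<open>1 < b\<close> by (intro divide_nonpos_pos) auto
  finally show ?thesis by simp
qed

lemma network_density_pos:
  "z \<in> set_pmf q \<Longrightarrow> network_density I f g q z > 0"
  unfolding network_density_def by (intro prod_pos cond_prob_fiber_pos ballI)

text \<open>The inclusion of supports makes every factor nonzero wherever \<open>t\<close> has mass,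
  so the logarithm splits there; elsewhere both sides carry the weight 0.\<close>

lemma sum_log_network_density:
  assumes "finite I" "set_pmf t \<subseteq> set_pmf q"
  shows "(\<Sum>z\<in>Z. pmf t z * log b (network_density I f g q z))
    = (\<Sum>i\<in>I. \<Sum>z\<in>Z. pmf t z * log b (\<P>(w in q. f i w = f i z \<bar> g i w = g i z)))"
proof -
  have "pmf t z * log b (network_density I f g q z)
    = (\<Sum>i\<in>I. pmf t z * log b (\<P>(w in q. f i w = f i z \<bar> g i w = g i z)))" for z
  proof (cases "z \<in> set_pmf t")
    case True
    then have "\<P>(w in q. f i w = f i z \<bar> g i w = g i z) \<noteq> 0" for i
      using cond_prob_fiber_pos[of z q "f i" "g i"] assms(2) by auto
    then show ?thesis
      by (simp add: network_density_def log_def ln_prod assms(1) sum_divide_distrib sum_distrib_left)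
  qed (simp add: set_pmf_iff)
  then show ?thesis
    by (simp only:) (rule sum.swap)
qed

text \<open>A conditional probability is a quotient of two marginals, and averaging the logarithm of
  a marginal under \<open>t\<close> itself collapses to a sum over its values.\<close>

lemma sum_log_network_density_self:
  assumes "finite I" "finite Z" "set_pmf t \<subseteq> Z"
  shows "(\<Sum>z\<in>Z. pmf t z * log b (network_density I f g t z)) = avg_loglik b I f g Z (pmf t)"
proof -
  have "(\<Sum>z\<in>Z. pmf t z * log b (\<P>(w in t. f i w = f i z \<bar> g i w = g i z)))
    = marginal_log_sum b Z (pmf t) (\<lambda>z. (f i z, g i z)) - marginal_log_sum b Z (pmf t) (g i)" for i
  proof -
    have "pmf t z * log b (\<P>(w in t. f i w = f i z \<bar> g i w = g i z))
      = pmf t z * log b (measure_pmf.prob t {w. (f i w, g i w) = (f i z, g i z)})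
        - pmf t z * log b (measure_pmf.prob t {w. g i w = g i z})" for z
    proof (cases "z \<in> set_pmf t")
      case True
      then show ?thesis
        using prob_fiber_pos[OF True, of "\<lambda>z. (f i z, g i z)"] prob_fiber_pos[OF True, of "g i"]
        by (simp add: cond_prob_fiber log_def ln_div diff_divide_distrib right_diff_distrib)
    qed (simp add: set_pmf_iff)
    then show ?thesis
      using sum_pmf_log_fiber[OF assms(2,3), of b "\<lambda>z. (f i z, g i z)"]
        sum_pmf_log_fiber[OF assms(2,3), of b "g i"]
      by (simp add: sum_subtractf)
  qed
  then show ?thesis
    by (simp add: sum_log_network_density[OF assms(1) subset_refl] avg_loglik_def)
qed

text \<open>Gibbs' inequality node by node. The bound depends on \<open>t\<close> alone, which makes
  it uniform over the class.\<close>

lemma sum_log_network_density_le: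
  assumes "1 < b" "finite I" "finite Z" "set_pmf q \<subseteq> Z" "set_pmf t \<subseteq> set_pmf q"
  shows "(\<Sum>z\<in>Z. pmf t z * log b (network_density I f g q z)) \<le> avg_loglik b I f g Z (pmf t)"
proof -
  have "set_pmf t \<subseteq> Z" using assms by auto
  show ?thesis
    unfolding sum_log_network_density_self[OF assms(2,3) \<open>set_pmf t \<subseteq> Z\<close>, symmetric]
      sum_log_network_density[OF assms(2,5)] sum_log_network_density[OF assms(2) subset_refl]
    by (intro sum_mono Gibbs_inequality_cond_prob assms)
qed

section \<open>Empirical distributions, likelihood and divergence\<close>

lemma (in prob_space) tendsto_in_probability_marginal_log_sum:
  assumes "\<And>z. z \<in> Z \<Longrightarrow> tendsto_in_probability M (\<lambda>m \<omega>. V m \<omega> z) (v z)"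
  shows "tendsto_in_probability M (\<lambda>m \<omega>. marginal_log_sum b Z (V m \<omega>) h) (marginal_log_sum b Z v h)"
  unfolding marginal_log_sum_def
  by (intro tendsto_in_probability_sum tendsto_in_probability_isCont[OF _ isCont_x_log_x] assms)
    auto

lemma (in prob_space) tendsto_in_probability_avg_loglik:
  assumes "\<And>z. z \<in> Z \<Longrightarrow> tendsto_in_probability M (\<lambda>m \<omega>. V m \<omega> z) (v z)"
  shows "tendsto_in_probability M (\<lambda>m \<omega>. avg_loglik b I f g Z (V m \<omega>)) (avg_loglik b I f g Z v)"
  unfolding avg_loglik_def
  by (intro tendsto_in_probability_sum tendsto_in_probability_diff
      tendsto_in_probability_marginal_log_sum assms)

text \<open>The sample is read off at a uniformly chosen index. As \<open>pmf_of_set\<close> has its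
  meaning only on nonempty sets, the facts about it assume \<open>1 \<le> m\<close>.\<close>

definition empirical_pmf :: "nat \<Rightarrow> (nat \<Rightarrow> 'z) \<Rightarrow> 'z pmf" where
  "empirical_pmf m s = map_pmf s (pmf_of_set {..<m})"

lemma
  assumes "1 \<le> m"
  shows set_empirical_pmf: "set_pmf (empirical_pmf m s) = s ` {..<m}"
    and pmf_empirical_pmf: "pmf (empirical_pmf m s) z = real (card {k\<in>{..<m}. s k = z}) / real m"
proof -
  have ne: "{..<m} \<noteq> {}" using assms by (auto simp: lessThan_empty_iff)
  then show "set_pmf (empirical_pmf m s) = s ` {..<m}"
    by (simp add: empirical_pmf_def)
  have "{..<m} \<inter> s -` {z} = {k\<in>{..<m}. s k = z}" by auto
  with ne show "pmf (empirical_pmf m s) z = real (card {k\<in>{..<m}. s k = z}) / real m"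
    by (simp add: empirical_pmf_def pmf_map measure_pmf_of_set)
qed

text \<open>This separates off the likelihood 0, for which the real logarithm does not give the
  intended value minus infinity.\<close>

lemma likelihood_pos_iff:
  assumes "1 \<le> m"
  shows "likelihood m s q > 0 \<longleftrightarrow> set_pmf (empirical_pmf m s) \<subseteq> set_pmf q"
proof -
  have "likelihood m s q > 0 \<longleftrightarrow> (\<forall>k<m. pmf q (s k) \<noteq> 0)"
    by (auto simp: likelihood_def order_less_le prod_nonneg)
  then show ?thesis
    by (auto simp: set_empirical_pmf[OF assms] set_pmf_iff)
qed

text \<open>Grouping the sample by its values turns the sum over indices into \<open>m\<close> times
  a cross entropy with the relative frequencies as weights.\<close>

lemma log_likelihood:
  assumes "1 \<le> m" "finite Z" "set_pmf (empirical_pmf m s) \<subseteq> Z"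
    "set_pmf (empirical_pmf m s) \<subseteq> set_pmf q"
  shows "log b (likelihood m s q) = real m * (\<Sum>z\<in>Z. pmf (empirical_pmf m s) z * log b (pmf q z))"
proof -
  have s: "s ` {..<m} \<subseteq> Z" "s ` {..<m} \<subseteq> set_pmf q"
    using assms by (auto simp: set_empirical_pmf)
  have "log b (likelihood m s q) = (\<Sum>k<m. log b (pmf q (s k)))"
  proof -
    have "pmf q (s k) \<noteq> 0" if "k < m" for k
      using s(2) that by (auto simp: set_pmf_iff)
    then have "ln (\<Prod>k<m. pmf q (s k)) = (\<Sum>k<m. ln (pmf q (s k)))"
      by (intro ln_prod) auto
    then show ?thesis
      by (simp add: likelihood_def log_def sum_divide_distrib)
  qed
  also have "\<dots> = (\<Sum>z\<in>s ` {..<m}. \<Sum>k\<in>{k\<in>{..<m}. s k = z}. log b (pmf q (s k)))"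
    by (rule sum.image_gen) simp
  also have "\<dots> = (\<Sum>z\<in>s ` {..<m}. real m * (pmf (empirical_pmf m s) z * log b (pmf q z)))"
    using assms(1) by (simp add: pmf_empirical_pmf)
  also have "\<dots> = (\<Sum>z\<in>Z. real m * (pmf (empirical_pmf m s) z * log b (pmf q z)))"
    using s assms by (intro sum.mono_neutral_left) (auto simp: pmf_eq_0_set_pmf set_empirical_pmf)
  finally show ?thesis by (simp add: sum_distrib_left)
qed

lemma KL_divergence_measure_pmf:
  fixes t q :: "'z pmf"
  assumes "1 < b" "finite Z" "set_pmf q \<subseteq> Z" "set_pmf t \<subseteq> set_pmf q"
  shows "KL_divergence b (measure_pmf q) (measure_pmf t)
    = (\<Sum>z\<in>Z. pmf t z * log b (pmf t z)) - (\<Sum>z\<in>Z. pmf t z * log b (pmf q z))"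
proof -
  let ?r = "\<lambda>z. pmf t z / pmf q z"
  \<comment> \<open>Where \<open>pmf q z = 0\<close>, the inclusion of supports gives
    \<open>pmf t z = 0\<close>, so the quotient is a density of \<open>t\<close> with respect to
    \<open>q\<close>.\<close>
  have "ennreal (pmf q z) * ennreal (?r z) = ennreal (pmf t z)" for z
    using assms(4) by (cases "pmf q z = 0") (auto simp: set_pmf_iff simp flip: ennreal_mult)
  then have "measure_pmf t = density (measure_pmf q) (\<lambda>z. ennreal (?r z))"
    by (simp add: measure_pmf_eq_density density_density_eq)
  then have "KL_divergence b (measure_pmf q) (measure_pmf t) = (\<integral>z. ?r z * log b (?r z) \<partial>q)"
    using \<open>1 < b\<close> by (simp add: sigma_finite_measure.KL_density[OF measure_pmf.sigma_finite_measure_axioms])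
  also have "\<dots> = (\<Sum>z\<in>Z. ?r z * log b (?r z) * pmf q z)"
    using assms(2,3) by (intro integral_measure_pmf_real) auto
  also have "\<dots> = (\<Sum>z\<in>Z. pmf t z * log b (pmf t z) - pmf t z * log b (pmf q z))"
  proof (rule sum.cong)
    fix z
    show "?r z * log b (?r z) * pmf q z = pmf t z * log b (pmf t z) - pmf t z * log b (pmf q z)"
    proof (cases "pmf t z = 0")
      case False
      moreover from this have "pmf q z \<noteq> 0"
        using assms(4) by (auto simp: set_pmf_iff)
      ultimately have "?r z * log b (?r z) * pmf q z = pmf t z * log b (?r z)"
        "log b (?r z) = log b (pmf t z) - log b (pmf q z)"
        by (simp_all add: log_def ln_div diff_divide_distrib)
      then show ?thesis by (simp only: right_diff_distrib)
    qed simp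
  qed simp
  finally show ?thesis by (simp add: sum_subtractf)
qed

text \<open>\<open>projection\<close> asks for a member with the conditionals of \<open>t\<close>,
  but only on the support of \<open>t\<close>: cross entropies weighted by \<open>t\<close> see
  nothing else, and in the head-to-head class a member may have to put mass elsewhere.\<close>

locale network_class =
  fixes Z :: "'z set" and C :: "'z pmf set" and I :: "'i set"
    and f :: "'i \<Rightarrow> 'z \<Rightarrow> 'c" and g :: "'i \<Rightarrow> 'z \<Rightarrow> 'd"
  assumes finite_Z: "finite Z" and finite_I: "finite I"
    and support: "q \<in> C \<Longrightarrow> set_pmf q \<subseteq> Z"
    and factorization: "q \<in> C \<Longrightarrow> z \<in> Z \<Longrightarrow> pmf q z = network_density I f g q z"
    and projection: "set_pmf t \<subseteq> Z \<Longrightarrow> \<exists>q\<in>C. \<forall>z\<in>set_pmf t. pmf q z = network_density I f g t z"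
begin

lemma cross_entropy_le:
  assumes "1 < b" "q \<in> C" "set_pmf t \<subseteq> set_pmf q"
  shows "(\<Sum>z\<in>Z. pmf t z * log b (pmf q z)) \<le> avg_loglik b I f g Z (pmf t)"
  using sum_log_network_density_le[OF assms(1) finite_I finite_Z support[OF assms(2)] assms(3),
      of f g] assms(2)
  by (simp add: factorization)

text \<open>The factorized density of \<open>t\<close> is positive on the support of
  \<open>t\<close>, so the projection covers that support and attains the upper bound.\<close>

lemma cross_entropy_attained:
  assumes "set_pmf t \<subseteq> Z"
  obtains q where "q \<in> C" "set_pmf t \<subseteq> set_pmf q"
    "(\<Sum>z\<in>Z. pmf t z * log b (pmf q z)) = avg_loglik b I f g Z (pmf t)"
proof -
  obtain q where q: "q \<in> C" "\<forall>z\<in>set_pmf t. pmf q z = network_density I f g t z"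
    using projection[OF assms] by blast
  show thesis
  proof (rule that)
    show "q \<in> C" by fact
    show "set_pmf t \<subseteq> set_pmf q"
    proof
      fix z assume "z \<in> set_pmf t"
      then have "pmf q z > 0" using q(2) network_density_pos[of z t I f g] by simp
      then show "z \<in> set_pmf q" by (simp add: set_pmf_iff)
    qed
    show "(\<Sum>z\<in>Z. pmf t z * log b (pmf q z)) = avg_loglik b I f g Z (pmf t)"
      unfolding sum_log_network_density_self[OF finite_I finite_Z assms, symmetric]
    proof (rule sum.cong[OF refl])
      show "pmf t z * log b (pmf q z) = pmf t z * log b (network_density I f g t z)" for z
        using q(2) by (cases "z \<in> set_pmf t") (auto simp: set_pmf_iff)
    qed
  qed
qed

text \<open>The divergence is a term depending on \<open>t\<close> only minus the cross entropy sum,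
  so the maximizer of the latter is a minimizer; members that do not cover the support of
  \<open>t\<close> have divergence \<open>\<infinity>\<close>.\<close>

lemma INF_KL:
  assumes "1 < b" "set_pmf t \<subseteq> Z"
  shows "(INF q\<in>C. KL b t q)
    = ereal ((\<Sum>z\<in>Z. pmf t z * log b (pmf t z)) - avg_loglik b I f g Z (pmf t))"
proof -
  obtain q where q: "q \<in> C" "set_pmf t \<subseteq> set_pmf q"
    "(\<Sum>z\<in>Z. pmf t z * log b (pmf q z)) = avg_loglik b I f g Z (pmf t)"
    by (rule cross_entropy_attained[OF assms(2)])
  have KL: "KL b t r = (if set_pmf t \<subseteq> set_pmf r
      then ereal ((\<Sum>z\<in>Z. pmf t z * log b (pmf t z)) - (\<Sum>z\<in>Z. pmf t z * log b (pmf r z)))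
      else \<infinity>)" if "r \<in> C" for r
    unfolding KL_def
    using KL_divergence_measure_pmf[OF assms(1) finite_Z support[OF that]] by simp
  have "KL b t q \<le> KL b t r" if "r \<in> C" for r
    using cross_entropy_le[OF assms(1) that, of t] q by (simp add: KL that)
  then have "(INF q\<in>C. KL b t q) = KL b t q"
    using q(1) by (intro cInf_eq_minimum) auto
  then show ?thesis using q by (simp add: KL)
qed

text \<open>The supremum is attained at the projection of the empirical distribution. Positive
  likelihoods are compared through their logarithms; a zero likelihood is below the positive maximum
  anyway.\<close>

lemma SUP_likelihood:
  assumes "1 < b" "1 \<le> m" "s ` {..<m} \<subseteq> Z"
  shows "(SUP q\<in>C. likelihood m s q) > 0"
    and "log b (SUP q\<in>C. likelihood m s q) = real m * avg_loglik b I f g Z (pmf (empirical_pmf m s))"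
proof -
  let ?t = "empirical_pmf m s"
  have tZ: "set_pmf ?t \<subseteq> Z" using assms by (simp add: set_empirical_pmf)
  obtain q where q: "q \<in> C" "set_pmf ?t \<subseteq> set_pmf q"
    "(\<Sum>z\<in>Z. pmf ?t z * log b (pmf q z)) = avg_loglik b I f g Z (pmf ?t)"
    by (rule cross_entropy_attained[OF tZ])
  have pos: "likelihood m s q > 0"
    using q assms(2) by (simp add: likelihood_pos_iff)
  have log_q: "log b (likelihood m s q) = real m * avg_loglik b I f g Z (pmf ?t)"
    using log_likelihood[OF assms(2) finite_Z tZ q(2)] q(3) by simp
  have le: "likelihood m s r \<le> likelihood m s q" if "r \<in> C" for r
  proof (cases "likelihood m s r > 0")
    case True
    then have sub: "set_pmf ?t \<subseteq> set_pmf r"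
      by (simp only: likelihood_pos_iff[OF assms(2)])
    have "log b (likelihood m s r) \<le> log b (likelihood m s q)"
      unfolding log_q log_likelihood[OF assms(2) finite_Z tZ sub]
      by (rule mult_left_mono[OF cross_entropy_le[OF assms(1) that sub]]) simp
    then show ?thesis
      by (simp only: log_le_cancel_iff[OF assms(1) True pos])
  qed (use pos in simp)
  have "(SUP q\<in>C. likelihood m s q) = likelihood m s q"
    using le q(1) by (intro cSup_eq_maximum) auto
  then show "(SUP q\<in>C. likelihood m s q) > 0"
    "log b (SUP q\<in>C. likelihood m s q) = real m * avg_loglik b I f g Z (pmf ?t)"
    using pos log_q by simp_all
qed

end

text \<open>For every \<open>m\<close> the normalized log ratio equals a fixed function of the
  relative frequencies exactly, and that function is continuous; the law of large numbers then gives
  the limit.\<close>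

lemma log_GLR_tendsto_in_probability:
  fixes S :: "nat \<Rightarrow> nat \<Rightarrow> 'v \<Rightarrow> 'z" and p :: "'z pmf"
  assumes C: "network_class Z C I f g" and C': "network_class Z C' I' f' g'"
    and "1 < b" and N: "prob_space N"
    and indep: "\<And>m. 1 \<le> m \<Longrightarrow> prob_space.indep_vars N (\<lambda>_. count_space Z) (S m) {..<m}"
    and distr: "\<And>m k. 1 \<le> m \<Longrightarrow> k < m \<Longrightarrow> distr N (count_space UNIV) (S m k) = measure_pmf p"
  shows "tendsto_in_probability N (\<lambda>m \<omega>. log_GLR b C C' m (\<lambda>k. S m k \<omega>) / real m)
    (avg_loglik b I f g Z (pmf p) - avg_loglik b I' f' g' Z (pmf p))"
proof -
  interpret N: prob_space N by fact
  interpret C: network_class Z C I f g by fact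
  interpret C': network_class Z C' I' f' g' by fact
  let ?v = "\<lambda>m \<omega> z. real (card {k\<in>{..<m}. S m k \<omega> = z}) / real m"
  have S: "S m k \<omega> \<in> Z" if "1 \<le> m" "k < m" "\<omega> \<in> space N" for m k \<omega>
    using indep[of m] that unfolding N.indep_vars_def measurable_def by auto
  have eq: "log_GLR b C C' m (\<lambda>k. S m k \<omega>) / real m
      = avg_loglik b I f g Z (?v m \<omega>) - avg_loglik b I' f' g' Z (?v m \<omega>)"
    if "\<omega> \<in> space N" for m \<omega>
  proof (cases "1 \<le> m")
    case True
    let ?s = "\<lambda>k. S m k \<omega>"
    have s: "?s ` {..<m} \<subseteq> Z" using S True that by auto
    have v: "?v m \<omega> = pmf (empirical_pmf m ?s)"
      using True by (simp add: pmf_empirical_pmf fun_eq_iff)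
    have "log_GLR b C C' m ?s
      = log b (SUP q\<in>C. likelihood m ?s q) - log b (SUP q\<in>C'. likelihood m ?s q)"
      using C.SUP_likelihood(1)[OF \<open>1 < b\<close> True s] C'.SUP_likelihood(1)[OF \<open>1 < b\<close> True s]
      by (simp add: log_GLR_def log_def ln_div diff_divide_distrib)
    also have "\<dots> = real m * (avg_loglik b I f g Z (?v m \<omega>) - avg_loglik b I' f' g' Z (?v m \<omega>))"
      unfolding v C.SUP_likelihood(2)[OF \<open>1 < b\<close> True s] C'.SUP_likelihood(2)[OF \<open>1 < b\<close> True s]
      by (simp add: right_diff_distrib)
    finally show ?thesis using True by simp
  next
    \<comment> \<open>For \<open>m = 0\<close> both sides are 0: division by 0 gives 0 on the left
      and makes all frequencies 0 on the right.\<close>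
    case False
    then show ?thesis by (simp add: avg_loglik_def marginal_log_sum_def not_le)
  qed
  show ?thesis
    by (rule N.tendsto_in_probability_cong[OF _ eq])
      (intro N.tendsto_in_probability_diff N.tendsto_in_probability_avg_loglik
        N.tendsto_in_probability_relative_frequency[of Z] indep distr)
qed

section \<open>The head-to-head and tail-to-tail classes\<close>

text \<open>A single node without parents imposes no restriction, and every distribution is its own
  projection.\<close>

lemma network_class_all_pmfs:
  assumes "finite Z"
  shows "network_class Z {q. set_pmf q \<subseteq> Z} {()} (\<lambda>_ z. z) (\<lambda>_ _. ())"
proof -
  have density: "network_density {()} (\<lambda>_ z. z) (\<lambda>_ _. ()) q z = pmf q z" for q :: "'a pmf" and z
    by (simp add: network_density_def cond_prob_def measure_pmf_single)
  show ?thesis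
  proof
    show "\<exists>q\<in>{q. set_pmf q \<subseteq> Z}.
        \<forall>z\<in>set_pmf t. pmf q z = network_density {()} (\<lambda>_ z. z) (\<lambda>_ _. ()) t z"
      if "set_pmf t \<subseteq> Z" for t
      using that by (intro bexI[of _ t]) (auto simp: density)
  qed (use assms in \<open>simp_all add: density\<close>)
qed

section \<open>Mass functions of images, conditionals and mixtures\<close>

lemma prob_fiber_map_pmf: "measure_pmf.prob q {z. h z = c} = pmf (map_pmf h q) c"
  by (simp add: pmf_map vimage_def)

lemma pmf_map_cond_pmf:
  assumes "set_pmf t \<inter> s \<noteq> {}"
  shows "pmf (map_pmf h (cond_pmf t s)) c = measure t {z. h z = c \<and> z \<in> s} / measure t s"
proof -
  have "pmf (map_pmf h (cond_pmf t s)) c = measure (uniform_measure t s) (h -` {c})"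
    by (simp add: pmf_map cond_pmf.rep_eq[OF assms])
  also have "\<dots> = measure t (s \<inter> h -` {c}) / measure t s"
    using assms by (intro measure_uniform_measure) (auto simp: emeasure_measure_pmf_not_zero)
  also have "s \<inter> h -` {c} = {z. h z = c \<and> z \<in> s}" by auto
  finally show ?thesis .
qed

text \<open>The value \<open>h y x\<close> reveals both arguments, so only one component of the
  mixture charges it. It serves for pairs built in either order.\<close>

lemma pmf_bind_map_pmf_disjoint:
  assumes "\<And>y y' x x'. h y x = h y' x' \<Longrightarrow> y = y' \<and> x = x'"
  shows "pmf (bind_pmf P (\<lambda>y. map_pmf (h y) (D y))) (h y x) = pmf P y * pmf (D y) x"
proof -
  have "pmf (map_pmf (h y') (D y')) (h y x) = indicat_real {y} y' * pmf (D y) x" for y'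
  proof (cases "y' = y")
    case True
    have "inj (h y)" using assms by (auto intro!: injI)
    then show ?thesis using True by (simp add: pmf_map_inj')
  next
    case False
    then have "h y x \<notin> set_pmf (map_pmf (h y') (D y'))"
      using assms by fastforce
    then have "pmf (map_pmf (h y') (D y')) (h y x) = 0"
      by (simp only: set_pmf_iff not_not)
    then show ?thesis using False by simp
  qed
  then show ?thesis
    by (simp add: pmf_bind measure_pmf_single)
qed

text \<open>
  Node \<open>j < n\<close> carries \<open>X\<^sub>j\<close> and node \<open>n\<close> carries \<open>Y\<close>; the parent value \<open>None\<close> stands for conditioning on
  the sure event.
\<close>

definition node_value :: "nat \<Rightarrow> nat \<Rightarrow> (nat \<Rightarrow> 'a) \<times> 'b \<Rightarrow> 'a + 'b" where
  "node_value n i z = (if i < n then Inl (fst z i) else Inr (snd z))"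

definition tail_parent :: "nat \<Rightarrow> nat \<Rightarrow> (nat \<Rightarrow> 'a) \<times> 'b \<Rightarrow> 'b option" where
  "tail_parent n i z = (if i < n then Some (snd z) else None)"

definition head_parent :: "nat \<Rightarrow> nat \<Rightarrow> (nat \<Rightarrow> 'a) \<times> 'b \<Rightarrow> (nat \<Rightarrow> 'a) option" where
  "head_parent n i z = (if i < n then None else Some (fst z))"

section \<open>The two classes as network factorizations\<close>

lemma network_density_tail:
  "network_density {..n} (node_value n) (tail_parent n) q (x, y)
    = \<P>(z in q. snd z = y) * (\<Prod>j<n. \<P>(z in q. fst z j = x j \<bar> snd z = y))"
proof -
  let ?F = "\<lambda>i. \<P>(w in q. node_value n i w = node_value n i (x, y)
    \<bar> tail_parent n i w = tail_parent n i (x, y))"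
  have "network_density {..n} (node_value n) (tail_parent n) q (x, y) = (\<Prod>i\<in>insert n {..<n}. ?F i)"
    unfolding network_density_def by (rule prod.cong) auto
  also have "\<dots> = ?F n * (\<Prod>j<n. ?F j)"
    by (rule prod.insert) auto
  also have "(\<Prod>j<n. ?F j) = (\<Prod>j<n. \<P>(z in q. fst z j = x j \<bar> snd z = y))"
    by (rule prod.cong) (simp_all add: node_value_def tail_parent_def cond_prob_def)
  also have "?F n = \<P>(z in q. snd z = y)"
    by (simp add: node_value_def tail_parent_def cond_prob_def)
  finally show ?thesis .
qed

lemma network_density_head:
  "network_density {..n} (node_value n) (head_parent n) q (x, y)
    = \<P>(z in q. snd z = y \<bar> fst z = x) * (\<Prod>j<n. \<P>(z in q. fst z j = x j))"
proof -
  let ?F = "\<lambda>i. \<P>(w in q. node_value n i w = node_value n i (x, y)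
    \<bar> head_parent n i w = head_parent n i (x, y))"
  have "network_density {..n} (node_value n) (head_parent n) q (x, y) = (\<Prod>i\<in>insert n {..<n}. ?F i)"
    unfolding network_density_def by (rule prod.cong) auto
  also have "\<dots> = ?F n * (\<Prod>j<n. ?F j)"
    by (rule prod.insert) auto
  also have "(\<Prod>j<n. ?F j) = (\<Prod>j<n. \<P>(z in q. fst z j = x j))"
    by (rule prod.cong) (simp_all add: node_value_def head_parent_def cond_prob_def)
  also have "?F n = \<P>(z in q. snd z = y \<bar> fst z = x)"
    by (simp add: node_value_def head_parent_def cond_prob_def)
  finally show ?thesis .
qed

section \<open>Projections onto the two classes\<close>

lemma finite_alphabet:
  assumes "\<And>j. j < n \<Longrightarrow> finite (A j)" "finite B"
  shows "finite (alphabet n A B)"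
  unfolding alphabet_def using assms by (intro finite_cartesian_product finite_PiE) auto

text \<open>The default \<open>undefined\<close> of the product distribution is the value of
  extensional functions outside their domain.\<close>

lemma set_Pi_pmf_subset_PiE:
  fixes n :: nat
  assumes "\<And>j. j < n \<Longrightarrow> set_pmf (P j) \<subseteq> A j"
  shows "set_pmf (Pi_pmf {..<n} undefined P) \<subseteq> (\<Pi>\<^sub>E j\<in>{..<n}. A j)"
proof
  fix x assume "x \<in> set_pmf (Pi_pmf {..<n} undefined P)"
  then have x: "x \<in> PiE_dflt {..<n} undefined (set_pmf \<circ> P)"
    by (simp add: set_Pi_pmf)
  show "x \<in> (\<Pi>\<^sub>E j\<in>{..<n}. A j)"
  proof (rule PiE_I)
    show "x j \<in> A j" if "j \<in> {..<n}" for j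
      using x that assms[of j] by (auto simp: PiE_dflt_def)
    show "x j = undefined" if "j \<notin> {..<n}" for j
      using x that by (auto simp: PiE_dflt_def)
  qed
qed

lemma alphabet_component: "z \<in> alphabet n A B \<Longrightarrow> j < n \<Longrightarrow> fst z j \<in> A j"
  using PiE_mem[of "fst z" "{..<n}" A j] by (simp add: alphabet_def mem_Times_iff)

text \<open>\<open>Y\<close> is drawn from its law under \<open>t\<close>, then the components
  independently from their conditional laws given \<open>Y\<close>. This keeps the law of each pair
  of a component and \<open>Y\<close>, and the tail-to-tail factors depend on these laws
  alone.\<close>

lemma tail_to_tail_projection:
  fixes t :: "((nat \<Rightarrow> 'a) \<times> 'b) pmf"
  assumes "set_pmf t \<subseteq> alphabet n A B"
  shows "\<exists>q\<in>tail_to_tail n A B. \<forall>z\<in>set_pmf t.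
    pmf q z = network_density {..n} (node_value n) (tail_parent n) t z"
proof -
  define E where "E = (\<lambda>y. cond_pmf t {z. snd z = y})"
  define D where "D = (\<lambda>y. Pi_pmf {..<n} undefined (\<lambda>j. map_pmf (\<lambda>z. fst z j) (E y)))"
  define q where "q = bind_pmf (map_pmf snd t) (\<lambda>y. map_pmf (\<lambda>x. (x, y)) (D y))"
  have ne: "set_pmf t \<inter> {z. snd z = y} \<noteq> {}" if "y \<in> snd ` set_pmf t" for y
    using that by auto
  have E: "set_pmf (E y) = set_pmf t \<inter> {z. snd z = y}" if "y \<in> snd ` set_pmf t" for y
    unfolding E_def by (rule set_cond_pmf[OF ne[OF that]])
  have bind_E: "bind_pmf (map_pmf snd t) E = t"
    unfolding E_def by (rule bind_cond_pmf_cancel) (auto simp: vimage_def)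
  have snd_q: "map_pmf snd q = map_pmf snd t"
    by (simp add: q_def map_bind_pmf pmf.map_comp o_def bind_return_pmf')
  have pair_q: "map_pmf (\<lambda>z. (fst z j, snd z)) q = map_pmf (\<lambda>z. (fst z j, snd z)) t"
    if "j < n" for j
  proof -
    have "map_pmf (\<lambda>z. (fst z j, snd z)) q
      = bind_pmf (map_pmf snd t) (\<lambda>y. map_pmf (\<lambda>a. (a, y)) (map_pmf (\<lambda>x. x j) (D y)))"
      by (simp add: q_def map_bind_pmf pmf.map_comp o_def)
    also have "\<dots> = bind_pmf (map_pmf snd t) (\<lambda>y. map_pmf (\<lambda>z. (fst z j, y)) (E y))"
      using that by (simp add: D_def Pi_pmf_component pmf.map_comp o_def)
    also have "\<dots> = bind_pmf (map_pmf snd t) (\<lambda>y. map_pmf (\<lambda>z. (fst z j, snd z)) (E y))"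
      by (intro bind_pmf_cong refl map_pmf_cong) (auto simp: E)
    also have "\<dots> = map_pmf (\<lambda>z. (fst z j, snd z)) (bind_pmf (map_pmf snd t) E)"
      by (simp add: map_bind_pmf)
    finally show ?thesis by (simp add: bind_E)
  qed
  have pmf_q: "pmf q (x, y) = network_density {..n} (node_value n) (tail_parent n) t (x, y)"
    if "(x, y) \<in> alphabet n A B" for x y
  proof (cases "y \<in> snd ` set_pmf t")
    case True
    have "pmf q (x, y) = pmf (map_pmf snd t) y * pmf (D y) x"
      unfolding q_def by (rule pmf_bind_map_pmf_disjoint[where h = "\<lambda>y x. (x, y)"]) auto
    also have "pmf (D y) x = (\<Prod>j<n. pmf (map_pmf (\<lambda>z. fst z j) (E y)) (x j))"
      unfolding D_def using that
      by (intro pmf_Pi') (auto simp: alphabet_def PiE_def extensional_def)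
    also have "\<dots> = (\<Prod>j<n. \<P>(z in t. fst z j = x j \<bar> snd z = y))"
      unfolding E_def pmf_map_cond_pmf[OF ne[OF True]] by (simp add: cond_prob_def)
    finally show ?thesis
      by (simp add: network_density_tail prob_fiber_map_pmf)
  next
    \<comment> \<open>Here \<open>E y\<close> conditions on a null event and is unspecified, but the
      mass of \<open>y\<close> is a vanishing factor on both sides.\<close>
    case False
    then have "pmf (map_pmf snd t) y = 0"
      by (simp add: pmf_eq_0_set_pmf)
    moreover have "pmf q (x, y) = pmf (map_pmf snd t) y * pmf (D y) x"
      unfolding q_def by (rule pmf_bind_map_pmf_disjoint[where h = "\<lambda>y x. (x, y)"]) auto
    ultimately show ?thesis
      by (simp add: network_density_tail prob_fiber_map_pmf)
  qed
  \<comment> \<open>The factorization computed from \<open>q\<close> is the one computed from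
    \<open>t\<close>, which makes \<open>q\<close> a member of the class.\<close>
  have density_q: "network_density {..n} (node_value n) (tail_parent n) q (x, y)
    = network_density {..n} (node_value n) (tail_parent n) t (x, y)" for x y
  proof -
    have "measure_pmf.prob q {z. fst z j = x j \<and> snd z = y}
      = measure_pmf.prob t {z. fst z j = x j \<and> snd z = y}" if "j < n" for j
      using prob_fiber_map_pmf[of q "\<lambda>z. (fst z j, snd z)" "(x j, y)"]
        prob_fiber_map_pmf[of t "\<lambda>z. (fst z j, snd z)" "(x j, y)"] pair_q[OF that] by simp
    then show ?thesis
      by (simp add: network_density_tail cond_prob_def prob_fiber_map_pmf[of _ snd] snd_q)
  qed
  have pmf_q': "pmf q (x, y) = network_density {..n} (node_value n) (tail_parent n) q (x, y)"
    if "(x, y) \<in> alphabet n A B" for x y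
    using pmf_q[OF that] by (simp only: density_q)
  have "set_pmf q \<subseteq> alphabet n A B"
  proof -
    have "set_pmf (D y) \<subseteq> (\<Pi>\<^sub>E j\<in>{..<n}. A j)" if "y \<in> snd ` set_pmf t" for y
      unfolding D_def using E[OF that] assms
      by (intro set_Pi_pmf_subset_PiE) (auto intro: alphabet_component)
    moreover have "snd ` set_pmf t \<subseteq> B"
      using assms by (auto simp: alphabet_def)
    ultimately show ?thesis
      unfolding q_def alphabet_def by fastforce
  qed
  then have "q \<in> tail_to_tail n A B"
    unfolding tail_to_tail_def all_distributions_def
    using pmf_q' by (auto simp: network_density_tail)
  with pmf_q assms show ?thesis
    by (intro bexI[of _ q]) auto
qed

lemma network_class_tail_to_tail:
  assumes "\<And>j. j < n \<Longrightarrow> finite (A j)" "finite B"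
  shows "network_class (alphabet n A B) (tail_to_tail n A B) {..n} (node_value n) (tail_parent n)"
proof
  show "finite (alphabet n A B)" by (rule finite_alphabet[OF assms])
next
  show "\<exists>q\<in>tail_to_tail n A B. \<forall>z\<in>set_pmf t.
      pmf q z = network_density {..n} (node_value n) (tail_parent n) t z"
    if "set_pmf t \<subseteq> alphabet n A B" for t :: "((nat \<Rightarrow> 'a) \<times> 'b) pmf"
    using that by (rule tail_to_tail_projection)
next
  show "pmf q z = network_density {..n} (node_value n) (tail_parent n) q z"
    if "q \<in> tail_to_tail n A B" "z \<in> alphabet n A B" for q z
    using that by (cases z) (auto simp: tail_to_tail_def network_density_tail)
next
  show "set_pmf q \<subseteq> alphabet n A B" if "q \<in> tail_to_tail n A B" for q
    using that by (simp only: tail_to_tail_def all_distributions_def mem_Collect_eq)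
qed simp

lemma head_to_head_projection:
  fixes t :: "((nat \<Rightarrow> 'a) \<times> 'b) pmf"
  assumes "set_pmf t \<subseteq> alphabet n A B"
  shows "\<exists>q\<in>head_to_head n A B. \<forall>z\<in>set_pmf t.
    pmf q z = network_density {..n} (node_value n) (head_parent n) t z"
proof -
  \<comment> \<open>A point \<open>x\<close> may have positive probability under the product of the marginals although \<open>t\<close> gives
    it none; there the conditional law of \<open>Y\<close> can be chosen arbitrarily.\<close>
  define P where "P = Pi_pmf {..<n} undefined (\<lambda>j. map_pmf (\<lambda>z. fst z j) t)"
  define K where "K = (\<lambda>x. if x \<in> fst ` set_pmf t
    then map_pmf snd (cond_pmf t {z. fst z = x}) else map_pmf snd t)"
  \<comment> \<open>The components are drawn independently from their marginals under
    \<open>t\<close>, then \<open>Y\<close> from the kernel \<open>K\<close>.\<close>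
  define q where "q = bind_pmf P (\<lambda>x. map_pmf (Pair x) (K x))"
  have pmf_q: "pmf q (x, y) = pmf P x * pmf (K x) y" for x y
    unfolding q_def by (rule pmf_bind_map_pmf_disjoint) auto
  have fst_q: "map_pmf fst q = P"
    by (simp add: q_def map_bind_pmf pmf.map_comp o_def bind_return_pmf')
  have "map_pmf (\<lambda>z. fst z j) q = map_pmf (\<lambda>x. x j) (map_pmf fst q)" for j
    by (simp add: pmf.map_comp o_def)
  then have component_q: "map_pmf (\<lambda>z. fst z j) q = map_pmf (\<lambda>z. fst z j) t" if "j < n" for j
    using that by (simp add: fst_q P_def Pi_pmf_component)
  have pmf_P: "pmf P x = (\<Prod>j<n. pmf (map_pmf (\<lambda>z. fst z j) t) (x j))"
    if "(x, y) \<in> alphabet n A B" for x and y :: 'b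
    unfolding P_def using that
    by (intro pmf_Pi') (auto simp: alphabet_def PiE_def extensional_def)
  have "pmf q (x, y) = network_density {..n} (node_value n) (head_parent n) q (x, y)"
    if "(x, y) \<in> alphabet n A B" for x y
  proof -
    have "{z. snd z = y \<and> fst z = x} = {(x, y)}" by auto
    \<comment> \<open>The conditional law of \<open>Y\<close> under \<open>q\<close> has denominator
      \<open>pmf P x\<close>. If this is 0 then so is \<open>pmf q (x, y)\<close>, so the
      cancellation below is sound in every case.\<close>
    then have "network_density {..n} (node_value n) (head_parent n) q (x, y)
      = pmf q (x, y) / pmf P x * pmf P x"
      by (simp add: network_density_head cond_prob_def prob_fiber_map_pmf fst_q pmf_P[OF that]
          component_q measure_pmf_single)
    then show ?thesis by (simp add: pmf_q)
  qed
  moreover have "set_pmf q \<subseteq> alphabet n A B"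
  proof -
    have "set_pmf P \<subseteq> (\<Pi>\<^sub>E j\<in>{..<n}. A j)"
      unfolding P_def using assms
      by (intro set_Pi_pmf_subset_PiE) (auto intro: alphabet_component)
    moreover have "set_pmf (K x) \<subseteq> B" for x
    proof (cases "x \<in> fst ` set_pmf t")
      case True
      then have "set_pmf t \<inter> {z. fst z = x} \<noteq> {}" by auto
      from set_cond_pmf[OF this] show ?thesis
        using assms True by (auto simp: K_def alphabet_def)
    qed (use assms in \<open>auto simp: K_def alphabet_def\<close>)
    ultimately show ?thesis
      unfolding q_def alphabet_def by fastforce
  qed
  ultimately have "q \<in> head_to_head n A B"
    unfolding head_to_head_def all_distributions_def by (auto simp: network_density_head)
  \<comment> \<open>Restricting to the support of \<open>t\<close> matters: there \<open>K x\<close>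
    is the conditional law under \<open>t\<close> and not the arbitrary choice.\<close>
  moreover have "pmf q (x, y) = network_density {..n} (node_value n) (head_parent n) t (x, y)"
    if "(x, y) \<in> set_pmf t" for x y
  proof -
    have "x \<in> fst ` set_pmf t" using that by force
    moreover have "set_pmf t \<inter> {z. fst z = x} \<noteq> {}" using that by auto
    ultimately have "pmf (K x) y = \<P>(z in t. snd z = y \<bar> fst z = x)"
      by (simp add: K_def pmf_map_cond_pmf cond_prob_def)
    moreover have "(x, y) \<in> alphabet n A B" using that assms by auto
    ultimately show ?thesis
      by (simp add: pmf_q pmf_P network_density_head prob_fiber_map_pmf)
  qed
  ultimately show ?thesis
    by (intro bexI[of _ q]) auto
qed

lemma network_class_head_to_head:
  assumes "\<And>j. j < n \<Longrightarrow> finite (A j)" "finite B"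
  shows "network_class (alphabet n A B) (head_to_head n A B) {..n} (node_value n) (head_parent n)"
proof
  show "finite (alphabet n A B)" by (rule finite_alphabet[OF assms])
next
  show "\<exists>q\<in>head_to_head n A B. \<forall>z\<in>set_pmf t.
      pmf q z = network_density {..n} (node_value n) (head_parent n) t z"
    if "set_pmf t \<subseteq> alphabet n A B" for t :: "((nat \<Rightarrow> 'a) \<times> 'b) pmf"
    using that by (rule head_to_head_projection)
next
  show "pmf q z = network_density {..n} (node_value n) (head_parent n) q z"
    if "q \<in> head_to_head n A B" "z \<in> alphabet n A B" for q z
    using that by (cases z) (auto simp: head_to_head_def network_density_head)
next
  show "set_pmf q \<subseteq> alphabet n A B" if "q \<in> head_to_head n A B" for q
    using that by (simp only: head_to_head_def all_distributions_def mem_Collect_eq)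
qed simp

section \<open>Mutual information and the redundancy-synergy index\<close>

text \<open>All laws entering the mutual informations are images of the one law \<open>p\<close>; on
  a finite set it suffices to compare point masses.\<close>

lemma (in prob_space) distributed_count_space_map_pmf:
  assumes "finite A" and U: "U \<in> measurable M (count_space A)"
    and W: "W \<in> measurable M (count_space UNIV)" "distr M (count_space UNIV) W = measure_pmf p"
    and f: "\<And>\<omega>. \<omega> \<in> space M \<Longrightarrow> U \<omega> = f (W \<omega>)"
  shows "distributed M (count_space A) U (\<lambda>a. ennreal (pmf (map_pmf f p) a))"
proof -
  have "distr M (count_space A) U = density (count_space A) (\<lambda>a. ennreal (pmf (map_pmf f p) a))"
  proof (rule measure_eqI_finite)
    fix a assume a: "a \<in> A"
    have "emeasure (distr M (count_space A) U) {a} = emeasure M (U -` {a} \<inter> space M)"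
      using a U by (intro emeasure_distr) auto
    also have "U -` {a} \<inter> space M = W -` (f -` {a}) \<inter> space M"
      using f by auto
    also have "emeasure M \<dots> = emeasure (distr M (count_space UNIV) W) (f -` {a})"
      by (rule emeasure_distr[symmetric]) (use W(1) in auto)
    also have "\<dots> = ennreal (pmf (map_pmf f p) a)"
      by (simp add: W(2) pmf_map measure_pmf.emeasure_eq_measure)
    also have "\<dots> = emeasure (density (count_space A) (\<lambda>a. ennreal (pmf (map_pmf f p) a))) {a}"
      using a \<open>finite A\<close>
      by (simp add: emeasure_density nn_integral_count_space_finite indicator_def if_distrib
          cong: if_cong)
    finally show "emeasure (distr M (count_space A) U) {a}
      = emeasure (density (count_space A) (\<lambda>a. ennreal (pmf (map_pmf f p) a))) {a}" .
  qed (use \<open>finite A\<close> in auto)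
  then show ?thesis
    using U by (simp add: distributed_def)
qed

text \<open>The sum over pairs of values is pulled back to \<open>Z\<close>, so that the mutual
  informations of different pairs become averages over one index set and can be combined
  pointwise.\<close>

lemma (in prob_space) mutual_information_eq_sum_pmf:
  assumes "1 < b" "finite A" "finite B"
    and U: "U \<in> measurable M (count_space A)" and V: "V \<in> measurable M (count_space B)"
    and W: "W \<in> measurable M (count_space UNIV)" "distr M (count_space UNIV) W = measure_pmf p"
    and f: "\<And>\<omega>. \<omega> \<in> space M \<Longrightarrow> U \<omega> = f (W \<omega>)"
    and g: "\<And>\<omega>. \<omega> \<in> space M \<Longrightarrow> V \<omega> = g (W \<omega>)"
    and Z: "finite Z" "set_pmf p \<subseteq> Z" "f ` Z \<subseteq> A" "g ` Z \<subseteq> B"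
  shows "mutual_information b (count_space A) (count_space B) U V
    = (\<Sum>z\<in>Z. pmf p z * log b (measure_pmf.prob p {w. (f w, g w) = (f z, g z)}
        / (measure_pmf.prob p {w. f w = f z} * measure_pmf.prob p {w. g w = g z})))"
proof -
  interpret information_space M b by standard fact
  let ?h = "\<lambda>z. (f z, g z)"
  let ?K = "\<lambda>c. log b (pmf (map_pmf ?h p) c / (pmf (map_pmf f p) (fst c) * pmf (map_pmf g p) (snd c)))"
  have pair: "count_space A \<Otimes>\<^sub>M count_space B = count_space (A \<times> B)"
    using \<open>finite A\<close> \<open>finite B\<close> by (intro pair_measure_countable countable_finite)
  have UV: "(\<lambda>\<omega>. (U \<omega>, V \<omega>)) \<in> measurable M (count_space (A \<times> B))"
    unfolding pair[symmetric] using U V by measurable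
  have "distributed M (count_space (A \<times> B)) (\<lambda>\<omega>. (U \<omega>, V \<omega>)) (\<lambda>c. ennreal (pmf (map_pmf ?h p) c))"
    by (rule distributed_count_space_map_pmf[OF _ UV W])
      (use \<open>finite A\<close> \<open>finite B\<close> f g in auto)
  then have "mutual_information b (count_space A) (count_space B) U V
    = (\<integral>c. pmf (map_pmf ?h p) c * ?K c \<partial>(count_space A \<Otimes>\<^sub>M count_space B))"
    using assms
    by (intro mutual_information_distr distributed_count_space_map_pmf[OF _ U W]
        distributed_count_space_map_pmf[OF _ V W])
      (auto simp: pair intro: sigma_finite_measure_count_space_finite)
  also have "\<dots> = (\<Sum>c\<in>A \<times> B. pmf (map_pmf ?h p) c * ?K c)"
    unfolding pair using \<open>finite A\<close> \<open>finite B\<close>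
    by (intro lebesgue_integral_count_space_finite finite_cartesian_product)
  also have "\<dots> = (\<Sum>c\<in>?h ` Z. pmf (map_pmf ?h p) c * ?K c)"
  proof (rule sum.mono_neutral_right)
    show "\<forall>c\<in>A \<times> B - ?h ` Z. pmf (map_pmf ?h p) c * ?K c = 0"
    proof
      fix c assume "c \<in> A \<times> B - ?h ` Z"
      then have "c \<notin> set_pmf (map_pmf ?h p)" using Z(2) by auto
      then show "pmf (map_pmf ?h p) c * ?K c = 0" by (simp only: set_pmf_iff) simp
    qed
  qed (use assms in auto)
  also have "\<dots> = (\<Sum>z\<in>Z. pmf p z * ?K (?h z))"
    unfolding prob_fiber_map_pmf[symmetric] by (rule sum_pmf_fiber[OF Z(1,2), symmetric])
  finally show ?thesis
    by (simp only: prob_fiber_map_pmf fst_conv snd_conv)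
qed

text \<open>The identity behind the index, before averaging: in the quotient of the tail and head
  factorizations the factors rearrange into quotients of joint by product probabilities. On the
  support of \<open>p\<close> all of them are positive, so logarithms may be taken.\<close>

lemma sum_log_density_ratio_eq_RSI_density:
  fixes p :: "((nat \<Rightarrow> 'a) \<times> 'b) pmf"
  assumes "z \<in> set_pmf p"
  shows "log b (network_density {..n} (node_value n) (tail_parent n) p z)
      - log b (network_density {..n} (node_value n) (head_parent n) p z)
    = (\<Sum>j<n. log b (measure_pmf.prob p {w. (fst w j, snd w) = (fst z j, snd z)}
        / (measure_pmf.prob p {w. fst w j = fst z j} * measure_pmf.prob p {w. snd w = snd z})))
      - log b (measure_pmf.prob p {w. (fst w, snd w) = (fst z, snd z)}
        / (measure_pmf.prob p {w. fst w = fst z} * measure_pmf.prob p {w. snd w = snd z}))"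
proof -
  have ln_prod_lessThan: "ln (\<Prod>j<n. c j) = (\<Sum>j<n. ln (c j))" if "\<And>j. c j > 0" for c :: "nat \<Rightarrow> real"
    by (rule ln_prod) (use that in \<open>auto simp: order_less_le\<close>)
  let ?P = "\<lambda>j. measure_pmf.prob p {w. fst w j = fst z j \<and> snd w = snd z}"
  let ?X = "\<lambda>j. measure_pmf.prob p {w. fst w j = fst z j}"
  let ?y = "measure_pmf.prob p {w. snd w = snd z}"
  let ?x = "measure_pmf.prob p {w. fst w = fst z}"
  let ?xy = "measure_pmf.prob p {w. fst w = fst z \<and> snd w = snd z}"
  have pos: "?P j > 0" "?X j > 0" "?y > 0" "?x > 0" "?xy > 0" for j
    using assms by (auto intro!: measure_pmf_posI[of z])
  have T: "ln (network_density {..n} (node_value n) (tail_parent n) p z)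
    = ln ?y + (\<Sum>j<n. ln (?P j) - ln ?y)"
  proof -
    have "network_density {..n} (node_value n) (tail_parent n) p z = ?y * (\<Prod>j<n. ?P j / ?y)"
      using network_density_tail[of n p "fst z" "snd z"] by (simp add: cond_prob_def)
    moreover have "(\<Prod>j<n. ?P j / ?y) > 0"
      using pos by (intro prod_pos) auto
    moreover have "ln (\<Prod>j<n. ?P j / ?y) = (\<Sum>j<n. ln (?P j) - ln ?y)"
      unfolding ln_divide_pos[OF pos(1,3), symmetric]
      by (rule ln_prod_lessThan) (use pos in simp)
    ultimately show ?thesis
      using pos(3) by (simp only: ln_mult_pos)
  qed
  have H: "ln (network_density {..n} (node_value n) (head_parent n) p z)
    = ln ?xy - ln ?x + (\<Sum>j<n. ln (?X j))"
  proof -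
    have "network_density {..n} (node_value n) (head_parent n) p z = (?xy / ?x) * (\<Prod>j<n. ?X j)"
      using network_density_head[of n p "fst z" "snd z"] by (simp add: cond_prob_def conj_commute)
    moreover have "(\<Prod>j<n. ?X j) > 0"
      using pos by (intro prod_pos) auto
    moreover have "ln (\<Prod>j<n. ?X j) = (\<Sum>j<n. ln (?X j))"
      by (rule ln_prod_lessThan) (use pos in simp)
    moreover have "?xy / ?x > 0"
      using pos by simp
    ultimately show ?thesis
      by (simp only: ln_mult_pos ln_divide_pos[OF pos(5,4)])
  qed
  have I: "ln (?P j / (?X j * ?y)) = ln (?P j) - ln ?y - ln (?X j)" for j
    by (simp only: ln_divide_pos[OF pos(1) mult_pos_pos[OF pos(2,3)]] ln_mult_pos[OF pos(2,3)])
  have J: "ln (?xy / (?x * ?y)) = ln ?xy - ln ?x - ln ?y"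
    by (simp only: ln_divide_pos[OF pos(5) mult_pos_pos[OF pos(4,3)]] ln_mult_pos[OF pos(4,3)]
        diff_diff_add)
  show ?thesis
    unfolding log_def T H prod.inject I J
    by (simp only: sum_divide_distrib[symmetric] sum_subtractf)
      (simp add: diff_divide_distrib add_divide_distrib)
qed

text \<open>The pointwise identity is averaged over \<open>p\<close>; points outside the support
  have weight 0.\<close>

lemma RSI_eq_avg_loglik_diff:
  fixes p :: "((nat \<Rightarrow> 'a) \<times> 'b) pmf"
  assumes "1 < b" and A: "\<And>j. j < n \<Longrightarrow> finite (A j)" and B: "finite B" and "prob_space M"
    and X: "\<And>j. j < n \<Longrightarrow> X j \<in> measurable M (count_space (A j))"
    and Y: "Y \<in> measurable M (count_space B)"
    and W: "distr M (count_space UNIV) (\<lambda>\<omega>. (random_vector n X \<omega>, Y \<omega>)) = measure_pmf p"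
  shows "set_pmf p \<subseteq> alphabet n A B"
    and "RSI b M n A B X Y
      = avg_loglik b {..n} (node_value n) (tail_parent n) (alphabet n A B) (pmf p)
        - avg_loglik b {..n} (node_value n) (head_parent n) (alphabet n A B) (pmf p)"
proof -
  interpret prob_space M by fact
  let ?W = "\<lambda>\<omega>. (random_vector n X \<omega>, Y \<omega>)"
  let ?Z = "alphabet n A B" and ?E = "\<Pi>\<^sub>E j\<in>{..<n}. A j"
  have "finite ?E" using A by (intro finite_PiE) auto
  have "finite ?Z" using A B by (rule finite_alphabet)
  \<comment> \<open>Over a finite space measurability can be checked on single points, whose
    preimages are finite intersections of preimages under the components.\<close>
  have Xv: "random_vector n X \<in> measurable M (count_space ?E)"
  proof (subst measurable_count_space_eq2[OF \<open>finite ?E\<close>], intro conjI ballI)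
    show "random_vector n X \<in> space M \<rightarrow> ?E"
      using measurable_space[OF X] by (auto simp: random_vector_def)
    fix x assume x: "x \<in> ?E"
    have "random_vector n X \<omega> = x \<longleftrightarrow> (\<forall>j\<in>{..<n}. X j \<omega> = x j)" for \<omega>
      using PiE_arb[OF x] by (auto simp: random_vector_def fun_eq_iff)
    then have "random_vector n X -` {x} \<inter> space M = {\<omega>\<in>space M. \<forall>j\<in>{..<n}. X j \<omega> = x j}"
      by auto
    also have "\<dots> \<in> sets M"
    proof (rule sets.sets_Collect_finite_All)
      fix j assume j: "j \<in> {..<n}"
      then have "X j -` {x j} \<inter> space M \<in> sets M"
        using PiE_mem[OF x j] by (intro measurable_sets[OF X]) auto
      then show "{\<omega>\<in>space M. X j \<omega> = x j} \<in> sets M"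
        by (simp add: vimage_def Int_def conj_commute)
    qed simp
    finally show "random_vector n X -` {x} \<inter> space M \<in> sets M" .
  qed
  have "?W \<in> measurable M (count_space ?E \<Otimes>\<^sub>M count_space B)"
    using Xv Y by measurable
  also have "count_space ?E \<Otimes>\<^sub>M count_space B = count_space ?Z"
    unfolding alphabet_def using \<open>finite ?E\<close> B by (intro pair_measure_countable countable_finite)
  finally have WZ: "?W \<in> measurable M (count_space ?Z)" .
  have W': "?W \<in> measurable M (count_space UNIV)"
    by (rule measurable_compose[OF WZ, where g = "\<lambda>x. x"]) auto
  \<comment> \<open>Almost sure membership under a mass function is containment of its
    support.\<close>
  have "AE z in distr M (count_space UNIV) ?W. z \<in> ?Z"
    using measurable_space[OF WZ] by (subst AE_distr_iff[OF W']) auto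
  then show supp: "set_pmf p \<subseteq> ?Z"
    unfolding W AE_measure_pmf_iff by blast
  have IX: "mutual_information b (count_space (A j)) (count_space B) (X j) Y
    = (\<Sum>z\<in>?Z. pmf p z * log b (measure_pmf.prob p {w. (fst w j, snd w) = (fst z j, snd z)}
        / (measure_pmf.prob p {w. fst w j = fst z j} * measure_pmf.prob p {w. snd w = snd z})))"
    if "j < n" for j
    by (rule mutual_information_eq_sum_pmf[OF \<open>1 < b\<close> A[OF that] B X[OF that] Y W' W])
      (use that \<open>finite ?Z\<close> supp in \<open>auto simp: random_vector_def alphabet_def\<close>)
  have IV: "mutual_information b (count_space ?E) (count_space B) (random_vector n X) Y
    = (\<Sum>z\<in>?Z. pmf p z * log b (measure_pmf.prob p {w. (fst w, snd w) = (fst z, snd z)}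
        / (measure_pmf.prob p {w. fst w = fst z} * measure_pmf.prob p {w. snd w = snd z})))"
    by (rule mutual_information_eq_sum_pmf[OF \<open>1 < b\<close> \<open>finite ?E\<close> B Xv Y W' W])
      (use \<open>finite ?Z\<close> supp in \<open>auto simp: alphabet_def\<close>)
  let ?T = "network_density {..n} (node_value n) (tail_parent n) p"
  let ?H = "network_density {..n} (node_value n) (head_parent n) p"
  let ?i = "\<lambda>j z. log b (measure_pmf.prob p {w. (fst w j, snd w) = (fst z j, snd z)}
        / (measure_pmf.prob p {w. fst w j = fst z j} * measure_pmf.prob p {w. snd w = snd z}))"
  let ?v = "\<lambda>z. log b (measure_pmf.prob p {w. (fst w, snd w) = (fst z, snd z)}
        / (measure_pmf.prob p {w. fst w = fst z} * measure_pmf.prob p {w. snd w = snd z}))"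
  have "RSI b M n A B X Y = (\<Sum>j<n. \<Sum>z\<in>?Z. pmf p z * ?i j z) - (\<Sum>z\<in>?Z. pmf p z * ?v z)"
    unfolding RSI_def IV using IX by simp
  also have "\<dots> = (\<Sum>z\<in>?Z. pmf p z * ((\<Sum>j<n. ?i j z) - ?v z))"
    by (subst sum.swap) (simp only: sum_subtractf right_diff_distrib sum_distrib_left)
  also have "\<dots> = (\<Sum>z\<in>?Z. pmf p z * (log b (?T z) - log b (?H z)))"
  proof (rule sum.cong[OF refl])
    show "pmf p z * ((\<Sum>j<n. ?i j z) - ?v z) = pmf p z * (log b (?T z) - log b (?H z))" for z
    proof (cases "z \<in> set_pmf p")
      case True
      show ?thesis
        by (simp only: sum_log_density_ratio_eq_RSI_density[OF True])
    next
      case False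
      then have "pmf p z = 0" by (simp add: set_pmf_iff)
      then show ?thesis by (simp only: mult_zero_left)
    qed
  qed
  also have "\<dots> = (\<Sum>z\<in>?Z. pmf p z * log b (?T z)) - (\<Sum>z\<in>?Z. pmf p z * log b (?H z))"
    by (simp only: sum_subtractf right_diff_distrib)
  finally show "RSI b M n A B X Y
      = avg_loglik b {..n} (node_value n) (tail_parent n) ?Z (pmf p)
        - avg_loglik b {..n} (node_value n) (head_parent n) ?Z (pmf p)"
    by (simp only: sum_log_network_density_self[OF finite_atMost \<open>finite ?Z\<close> supp])
qed

theorem corollary3:
  fixes b :: real and n :: nat
    and A :: "nat \<Rightarrow> 'a set" and B :: "'b set"
    and M :: "'w measure" and X :: "nat \<Rightarrow> 'w \<Rightarrow> 'a" and Y :: "'w \<Rightarrow> 'b"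
    and p :: "((nat \<Rightarrow> 'a) \<times> 'b) pmf"
    and N :: "'v measure" and S :: "nat \<Rightarrow> nat \<Rightarrow> 'v \<Rightarrow> (nat \<Rightarrow> 'a) \<times> 'b"
  assumes "1 < b" and "2 \<le> n"
    and "\<And>j. j < n \<Longrightarrow> finite (A j)" and "finite B"
    and "prob_space M"
    and "\<And>j. j < n \<Longrightarrow> X j \<in> measurable M (count_space (A j))"
    and "Y \<in> measurable M (count_space B)"
    and "distr M (count_space UNIV) (\<lambda>\<omega>. (random_vector n X \<omega>, Y \<omega>)) = measure_pmf p"
    and "prob_space N"
    and "\<And>m. 1 \<le> m \<Longrightarrow>
           prob_space.indep_vars N (\<lambda>_. count_space (alphabet n A B)) (S m) {..<m}"
    and "\<And>m k. 1 \<le> m \<Longrightarrow> k < m \<Longrightarrow> distr N (count_space UNIV) (S m k) = measure_pmf p"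
  shows "\<exists>L\<^sub>H L\<^sub>T.
           tendsto_in_probability N
             (\<lambda>m \<omega>. log_GLR b (all_distributions n A B) (head_to_head n A B) m (\<lambda>k. S m k \<omega>) / real m)
             L\<^sub>H \<and>
           tendsto_in_probability N
             (\<lambda>m \<omega>. log_GLR b (all_distributions n A B) (tail_to_tail n A B) m (\<lambda>k. S m k \<omega>) / real m)
             L\<^sub>T \<and>
           RSI b M n A B X Y = L\<^sub>H - L\<^sub>T \<and>
           ereal (L\<^sub>H - L\<^sub>T) =
             (INF q\<in>head_to_head n A B. KL b p q) - (INF q\<in>tail_to_tail n A B. KL b p q)"
proof -
  let ?Z = "alphabet n A B"
  \<comment> \<open>This is minus the entropy of \<open>p\<close>; it is common to both limits and
    cancels in their difference.\<close>
  let ?M = "avg_loglik b {()} (\<lambda>_ z. z) (\<lambda>_ _. ()) ?Z (pmf p)"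
  let ?H = "avg_loglik b {..n} (node_value n) (head_parent n) ?Z (pmf p)"
  let ?T = "avg_loglik b {..n} (node_value n) (tail_parent n) ?Z (pmf p)"
  note RSI = RSI_eq_avg_loglik_diff[OF assms(1,3-8)]
  have all: "network_class ?Z (all_distributions n A B) {()} (\<lambda>_ z. z) (\<lambda>_ _. ())"
    unfolding all_distributions_def by (intro network_class_all_pmfs finite_alphabet assms)
  have head: "network_class ?Z (head_to_head n A B) {..n} (node_value n) (head_parent n)"
    by (intro network_class_head_to_head assms)
  have tail: "network_class ?Z (tail_to_tail n A B) {..n} (node_value n) (tail_parent n)"
    by (intro network_class_tail_to_tail assms)
  show ?thesis
  proof (intro exI conjI)
    show "tendsto_in_probability N
        (\<lambda>m \<omega>. log_GLR b (all_distributions n A B) (head_to_head n A B) m (\<lambda>k. S m k \<omega>) / real m)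
        (?M - ?H)"
      by (rule log_GLR_tendsto_in_probability[OF all head assms(1,9-11)])
    show "tendsto_in_probability N
        (\<lambda>m \<omega>. log_GLR b (all_distributions n A B) (tail_to_tail n A B) m (\<lambda>k. S m k \<omega>) / real m)
        (?M - ?T)"
      by (rule log_GLR_tendsto_in_probability[OF all tail assms(1,9-11)])
    show "RSI b M n A B X Y = (?M - ?H) - (?M - ?T)"
      by (simp add: RSI(2))
    \<comment> \<open>Both infima are finite, so the extended subtraction is the real one, and their
      common term depending only on \<open>p\<close> cancels.\<close>
    show "ereal ((?M - ?H) - (?M - ?T)) =
        (INF q\<in>head_to_head n A B. KL b p q) - (INF q\<in>tail_to_tail n A B. KL b p q)"
      by (simp add: network_class.INF_KL[OF head assms(1) RSI(1)]
          network_class.INF_KL[OF tail assms(1) RSI(1)])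
  qed
qed

end
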